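(* Let $\theta\ge1$, $\epsilon>0$, and let $\mathcal X=(X,d_X)$ and $\mathcal Y=(Y,d_Y)$ be compact $\theta$-metric spaces. Then: (i) if $d^\theta_{GH}(\mathcal X,\mathcal Y)<\epsilon$, then there exists a $(1+\theta)\epsilon$-isometry $f:\mathcal X\to\mathcal Y$; (ii) if there is an $\epsilon$-isometry $f:\mathcal X\to\mathcal Y$, then $d^\theta_{GH}(\mathcal X,\mathcal Y)\le2\epsilon$.
   Context: An irreversible metric on $X$ is $d:X\times X\to[0,\infty)$ with $d(x,y)=0$ iff $x=y$ and $d(x,z)\le d(x,y)+d(y,z)$ (no symmetry). The topology is generated by the forward balls $\{y:d(x,y)<r\}$. $(X,d)$ is a $\theta$-metric space if $d(x,y)\le\theta\,d(y,x)$ for all $x,y\in X$. For $A\subset X$, $A^\epsilon=\{x\in X:d(A,x)<\epsilon\}$ with $d(A,x)=\inf_{a\in A}d(a,x)$. An $\epsilon$-isometry $f:X\to Y$ is a (not necessarily continuous) map with $\sup_{x,x'\in X}|d_Y(f(x),f(x'))-d_X(x,x')|\le\epsilon$ and $Y\subset\overline{[f(X)]^\epsilon}$. A $\theta$-admissible metric on $X\sqcup Y$ is an irreversible metric $d$ making $X\sqcup Y$ a $\theta$-metric space and restricting to $d_X$ on $X$ and to $d_Y$ on $Y$. $d_H(A,B)=\inf\{\epsilon>0:A\subset B^\epsilon,\ B\subset A^\epsilon\}$, and $d^\theta_{GH}(\mathcal X,\mathcal Y)$ is the infimum of $d_H(X,Y)$ over all $\theta$-admissible metrics on $X\sqcup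 Y$. *)

theory Defs
  imports "HOL-Analysis.Analysis"
begin

text \<open>
  Spaces are carrier sets \<open>X\<close> with a distance function \<open>d\<close> that matters only on \<open>X\<close>. Infima
  and suprema are taken in the extended reals, so that an infimum over the empty set is
  \<open>\<infinity>\<close>; the empty space is thus covered without special conventions.
\<close>

definition irreversible_metric :: "'a set \<Rightarrow> ('a \<Rightarrow> 'a \<Rightarrow> real) \<Rightarrow> bool" where
  "irreversible_metric X d \<longleftrightarrow>
     (\<forall>x\<in>X. \<forall>y\<in>X. 0 \<le> d x y) \<and>
     (\<forall>x\<in>X. \<forall>y\<in>X. d x y = 0 \<longleftrightarrow> x = y) \<and>
     (\<forall>x\<in>X. \<forall>y\<in>X. \<forall>z\<in>X. d x z \<le> d x y + d y z)"

definition theta_metric_space :: "real \<Rightarrow> 'a set \<Rightarrow> ('a \<Rightarrow> 'a \<Rightarrow> real) \<Rightarrow> bool" where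
  "theta_metric_space \<theta> X d \<longleftrightarrow>
     irreversible_metric X d \<and> (\<forall>x\<in>X. \<forall>y\<in>X. d x y \<le> \<theta> * d y x)"

definition forward_ball :: "'a set \<Rightarrow> ('a \<Rightarrow> 'a \<Rightarrow> real) \<Rightarrow> 'a \<Rightarrow> real \<Rightarrow> 'a set" where
  "forward_ball X d x r = {y \<in> X. d x y < r}"

definition forward_topology :: "'a set \<Rightarrow> ('a \<Rightarrow> 'a \<Rightarrow> real) \<Rightarrow> 'a topology" where
  "forward_topology X d = topology_generated_by {forward_ball X d x r | x r. x \<in> X \<and> 0 < r}"

definition compact_theta_metric_space :: "real \<Rightarrow> 'a set \<Rightarrow> ('a \<Rightarrow> 'a \<Rightarrow> real) \<Rightarrow> bool" where
  "compact_theta_metric_space \<theta> X d \<longleftrightarrow>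
     theta_metric_space \<theta> X d \<and> compact_space (forward_topology X d)"

text \<open>Distances are measured from the set to the point; the order matters.\<close>

definition dist_from_set :: "('a \<Rightarrow> 'a \<Rightarrow> real) \<Rightarrow> 'a set \<Rightarrow> 'a \<Rightarrow> ereal" where
  "dist_from_set d A x = (INF a\<in>A. ereal (d a x))"

definition enlargement :: "'a set \<Rightarrow> ('a \<Rightarrow> 'a \<Rightarrow> real) \<Rightarrow> 'a set \<Rightarrow> real \<Rightarrow> 'a set" where
  "enlargement X d A \<epsilon> = {x \<in> X. dist_from_set d A x < ereal \<epsilon>}"

definition eps_isometry ::
  "real \<Rightarrow> 'a set \<Rightarrow> ('a \<Rightarrow> 'a \<Rightarrow> real) \<Rightarrow> 'b set \<Rightarrow> ('b \<Rightarrow> 'b \<Rightarrow> real) \<Rightarrow> ('a \<Rightarrow> 'b) \<Rightarrow> bool" where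
  "eps_isometry \<epsilon> X dX Y dY f \<longleftrightarrow>
     f \<in> X \<rightarrow> Y \<and>
     (SUP (x, x') \<in> X \<times> X. ereal \<bar>dY (f x) (f x') - dX x x'\<bar>) \<le> ereal \<epsilon> \<and>
     Y \<subseteq> forward_topology Y dY closure_of enlargement Y dY (f ` X) \<epsilon>"

definition hausdorff_distance ::
  "'a set \<Rightarrow> ('a \<Rightarrow> 'a \<Rightarrow> real) \<Rightarrow> 'a set \<Rightarrow> 'a set \<Rightarrow> ereal" where
  "hausdorff_distance Z d A B =
     Inf {ereal \<epsilon> | \<epsilon>. 0 < \<epsilon> \<and> A \<subseteq> enlargement Z d B \<epsilon> \<and> B \<subseteq> enlargement Z d A \<epsilon>}"

definition theta_admissible ::
  "real \<Rightarrow> 'a set \<Rightarrow> ('a \<Rightarrow> 'a \<Rightarrow> real) \<Rightarrow> 'b set \<Rightarrow> ('b \<Rightarrow> 'b \<Rightarrow> real) \<Rightarrow>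
     ('a + 'b \<Rightarrow> 'a + 'b \<Rightarrow> real) \<Rightarrow> bool" where
  "theta_admissible \<theta> X dX Y dY d \<longleftrightarrow>
     theta_metric_space \<theta> (X <+> Y) d \<and>
     (\<forall>x\<in>X. \<forall>x'\<in>X. d (Inl x) (Inl x') = dX x x') \<and>
     (\<forall>y\<in>Y. \<forall>y'\<in>Y. d (Inr y) (Inr y') = dY y y')"

definition theta_GH_distance ::
  "real \<Rightarrow> 'a set \<Rightarrow> ('a \<Rightarrow> 'a \<Rightarrow> real) \<Rightarrow> 'b set \<Rightarrow> ('b \<Rightarrow> 'b \<Rightarrow> real) \<Rightarrow> ereal" where
  "theta_GH_distance \<theta> X dX Y dY =
     Inf {hausdorff_distance (X <+> Y) d (Inl ` X) (Inr ` Y) | d. theta_admissible \<theta> X dX Y dY d}"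

end

theory Submission imports Defs begin

text \<open>
  For (i), send \<open>x\<close> to some \<open>y \<in> Y\<close> with \<open>d y x < \<epsilon>\<close>; reversing the arrow costs a factor
  \<open>\<theta>\<close>, so comparing \<open>dX x x'\<close> with \<open>dY (f x) (f x')\<close> costs \<open>\<epsilon> + \<theta> * \<epsilon>\<close>. For (ii), glue \<open>X\<close>
  to \<open>Y\<close> by arcs of length \<open>\<epsilon> / 2\<close>, in both directions, between each \<open>a \<in> X\<close> and \<open>f a\<close>, and take
  the infimal length of a passage through one arc. A detour through the other space uses two
  arcs, whose total length \<open>\<epsilon>\<close> makes up for the distortion of \<open>f\<close>.
\<close>

section \<open>Distances, the forward topology and \<epsilon>-isometries\<close>

lemma theta_metric_spaceD:
  assumes "theta_metric_space \<theta> X d"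
  shows theta_metric_nonneg: "\<lbrakk>x \<in> X; y \<in> X\<rbrakk> \<Longrightarrow> 0 \<le> d x y"
    and theta_metric_eq_0: "\<lbrakk>x \<in> X; y \<in> X\<rbrakk> \<Longrightarrow> d x y = 0 \<longleftrightarrow> x = y"
    and theta_metric_triangle: "\<lbrakk>x \<in> X; y \<in> X; z \<in> X\<rbrakk> \<Longrightarrow> d x z \<le> d x y + d y z"
    and theta_metric_reverse: "\<lbrakk>x \<in> X; y \<in> X\<rbrakk> \<Longrightarrow> d x y \<le> \<theta> * d y x"
  using assms unfolding theta_metric_space_def irreversible_metric_def by blast+

lemma mem_enlargement_iff:
  "x \<in> enlargement X d A \<epsilon> \<longleftrightarrow> x \<in> X \<and> (\<exists>a\<in>A. d a x < \<epsilon>)"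
  by (simp add: enlargement_def dist_from_set_def INF_less_iff)

lemma topspace_forward_topology:
  assumes "theta_metric_space \<theta> X d"
  shows "topspace (forward_topology X d) = X"
proof -
  have "x \<in> forward_ball X d x 1" if "x \<in> X" for x
    using that theta_metric_eq_0[OF assms that that] by (simp add: forward_ball_def)
  then have "X \<subseteq> \<Union>{forward_ball X d x r | x r. x \<in> X \<and> 0 < r}"
    by (smt (verit, best) UnionI mem_Collect_eq subsetI)
  then show ?thesis
    by (auto simp: forward_topology_def forward_ball_def)
qed

lemma openin_forward_ball:
  "\<lbrakk>x \<in> X; 0 < r\<rbrakk> \<Longrightarrow> openin (forward_topology X d) (forward_ball X d x r)"
  unfolding forward_topology_def by (rule topology_generated_by_Basis) blast

text \<open>The last hypothesis is the strict form that an enlargement asks for: it puts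
  \<open>Y\<close> inside the enlargement itself, hence inside its closure.\<close>

lemma eps_isometryI:
  assumes "theta_metric_space \<theta> Y dY" and "f \<in> X \<rightarrow> Y"
    and "\<And>x x'. \<lbrakk>x \<in> X; x' \<in> X\<rbrakk> \<Longrightarrow> \<bar>dY (f x) (f x') - dX x x'\<bar> \<le> \<epsilon>"
    and "\<And>y. y \<in> Y \<Longrightarrow> \<exists>x\<in>X. dY (f x) y < \<epsilon>"
  shows "eps_isometry \<epsilon> X dX Y dY f"
proof -
  let ?E = "enlargement Y dY (f ` X) \<epsilon>"
  have "Y \<subseteq> ?E"
    using assms(4) by (auto simp: mem_enlargement_iff)
  moreover have "?E \<subseteq> forward_topology Y dY closure_of ?E"
    by (rule closure_of_subset)
      (auto simp: topspace_forward_topology[OF assms(1)] mem_enlargement_iff)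
  ultimately show ?thesis
    unfolding eps_isometry_def using assms(2,3) by (auto intro!: SUP_least)
qed

lemma eps_isometryD:
  assumes "eps_isometry \<epsilon> X dX Y dY f"
  shows eps_isometry_funcset: "f \<in> X \<rightarrow> Y"
    and eps_isometry_distortion: "\<lbrakk>x \<in> X; x' \<in> X\<rbrakk> \<Longrightarrow> \<bar>dY (f x) (f x') - dX x x'\<bar> \<le> \<epsilon>"
proof -
  show "f \<in> X \<rightarrow> Y"
    using assms by (simp add: eps_isometry_def)
  assume "x \<in> X" "x' \<in> X"
  then have "ereal \<bar>dY (f x) (f x') - dX x x'\<bar>
      \<le> (SUP (x, x') \<in> X \<times> X. ereal \<bar>dY (f x) (f x') - dX x x'\<bar>)"
    by (intro SUP_upper2[where i = "(x, x')"]) auto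
  also have "\<dots> \<le> ereal \<epsilon>"
    using assms by (simp add: eps_isometry_def)
  finally show "\<bar>dY (f x) (f x') - dX x x'\<bar> \<le> \<epsilon>"
    by simp
qed

text \<open>Turns the closure in the definition into a pointwise estimate: a point of the closure is
  approximated by points of the enlargement, at an arbitrarily small extra cost
  \<open>\<delta>\<close>.\<close>

lemma eps_isometry_almost_onto:
  assumes "eps_isometry \<epsilon> X dX Y dY f" and Y: "theta_metric_space \<theta> Y dY"
    and "0 < \<theta>" and "0 < \<delta>" and y: "y \<in> Y"
  shows "\<exists>x\<in>X. dY (f x) y < \<epsilon> + \<delta>"
proof -
  note f = eps_isometry_funcset[OF assms(1)]
  have "y \<in> forward_topology Y dY closure_of enlargement Y dY (f ` X) \<epsilon>"
    using assms(1) y by (auto simp: eps_isometry_def)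
  \<comment> \<open>A forward ball about \<open>y\<close> bounds \<open>dY y y'\<close>, whereas the
    path from \<open>f x\<close> through \<open>y'\<close> to \<open>y\<close> needs
    \<open>dY y' y\<close>. Radius \<open>\<delta> / \<theta>\<close> leaves room for the factor
    \<open>\<theta>\<close> of the reversal.\<close>
  moreover have "openin (forward_topology Y dY) (forward_ball Y dY y (\<delta> / \<theta>))"
    using assms by (simp add: openin_forward_ball)
  moreover have "y \<in> forward_ball Y dY y (\<delta> / \<theta>)"
    using assms theta_metric_eq_0[OF Y y y] by (simp add: forward_ball_def)
  ultimately obtain y' where "y' \<in> enlargement Y dY (f ` X) \<epsilon>"
    and "y' \<in> forward_ball Y dY y (\<delta> / \<theta>)"
    by (meson in_closure_of)
  then obtain x where x: "x \<in> X" "dY (f x) y' < \<epsilon>" and y': "y' \<in> Y" "dY y y' < \<delta> / \<theta>"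
    by (auto simp: mem_enlargement_iff forward_ball_def)
  have "dY y' y \<le> \<theta> * dY y y'"
    using theta_metric_reverse[OF Y] y y' by simp
  also have "\<dots> < \<delta>"
    using y' \<open>0 < \<theta>\<close> by (simp add: pos_less_divide_eq mult.commute)
  finally have "dY (f x) y < \<epsilon> + \<delta>"
    using theta_metric_triangle[OF Y _ y'(1) y, of "f x"] f x by fastforce
  with x show ?thesis
    by blast
qed

section \<open>From small distance to an approximate isometry\<close>

lemma eps_isometry_of_theta_GH_less:
  assumes "1 \<le> \<theta>" and "theta_metric_space \<theta> Y dY"
    and "theta_GH_distance \<theta> X dX Y dY < ereal \<epsilon>"
  shows "\<exists>f. eps_isometry ((1 + \<theta>) * \<epsilon>) X dX Y dY f"
proof -
  let ?Z = "X <+> Y"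
  \<comment> \<open>Both infima lie strictly below \<open>\<epsilon>\<close>, so an actual
    admissible \<open>d\<close> and an actual radius \<open>e < \<epsilon>\<close> realize the
    bound.\<close>
  obtain d e where "theta_admissible \<theta> X dX Y dY d" and e: "0 < e" "e < \<epsilon>"
    and XY: "Inl ` X \<subseteq> enlargement ?Z d (Inr ` Y) e"
    and YX: "Inr ` Y \<subseteq> enlargement ?Z d (Inl ` X) e"
    using assms(3) by (auto simp: theta_GH_distance_def hausdorff_distance_def Inf_less_iff)
  then have d: "theta_metric_space \<theta> ?Z d"
    and dX: "\<And>x x'. \<lbrakk>x \<in> X; x' \<in> X\<rbrakk> \<Longrightarrow> d (Inl x) (Inl x') = dX x x'"
    and dY: "\<And>y y'. \<lbrakk>y \<in> Y; y' \<in> Y\<rbrakk> \<Longrightarrow> d (Inr y) (Inr y') = dY y y'"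
    by (auto simp: theta_admissible_def)
  note triangle = theta_metric_triangle[OF d]
  have "\<forall>x\<in>X. \<exists>y. y \<in> Y \<and> d (Inr y) (Inl x) < e"
    using XY by (auto simp: mem_enlargement_iff subset_iff)
  then obtain f where f: "\<And>x. x \<in> X \<Longrightarrow> f x \<in> Y" "\<And>x. x \<in> X \<Longrightarrow> d (Inr (f x)) (Inl x) < e"
    by metis
  have rev: "d (Inl x) (Inr (f x)) \<le> \<theta> * e" if "x \<in> X" for x
  proof -
    have "d (Inl x) (Inr (f x)) \<le> \<theta> * d (Inr (f x)) (Inl x)"
      using theta_metric_reverse[OF d] f that by blast
    also have "\<dots> \<le> \<theta> * e"
      using f(2)[OF that] assms(1) by simp
    finally show ?thesis .
  qed
  have le: "e + \<theta> * e \<le> (1 + \<theta>) * \<epsilon>"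
    using e assms(1) mult_left_mono[of e \<epsilon> "1 + \<theta>"] by (simp add: algebra_simps)
  have "eps_isometry ((1 + \<theta>) * \<epsilon>) X dX Y dY f"
  proof (rule eps_isometryI[OF assms(2)])
    show "f \<in> X \<rightarrow> Y"
      using f by blast
  next
    fix x x' assume x: "x \<in> X" "x' \<in> X"
    \<comment> \<open>Each of the two detours changes space once in each direction: from
      \<open>Y\<close> to \<open>X\<close> for less than \<open>e\<close>, from \<open>X\<close> to
      \<open>Y\<close> for at most \<open>\<theta> * e\<close>.\<close>
    then have "dY (f x) (f x') \<le> d (Inr (f x)) (Inl x) + dX x x' + d (Inl x') (Inr (f x'))"
      using triangle[of "Inr (f x)" "Inl x" "Inr (f x')"]
        triangle[of "Inl x" "Inl x'" "Inr (f x')"] f(1) dX dY by (simp add: InlI InrI)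
    moreover have "dX x x' \<le> d (Inl x) (Inr (f x)) + dY (f x) (f x') + d (Inr (f x')) (Inl x')"
      using triangle[of "Inl x" "Inr (f x)" "Inl x'"]
        triangle[of "Inr (f x)" "Inr (f x')" "Inl x'"] f(1) dX dY x by (simp add: InlI InrI)
    ultimately show "\<bar>dY (f x) (f x') - dX x x'\<bar> \<le> (1 + \<theta>) * \<epsilon>"
      using f(2)[OF x(1)] f(2)[OF x(2)] rev[OF x(1)] rev[OF x(2)] le by linarith
  next
    fix y assume y: "y \<in> Y"
    then obtain x where x: "x \<in> X" "d (Inl x) (Inr y) < e"
      using YX by (auto simp: mem_enlargement_iff subset_iff)
    \<comment> \<open>Both legs, \<open>f x\<close> to \<open>x\<close> and \<open>x\<close> to
      \<open>y\<close>, run in directions controlled by \<open>e\<close>; since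
      \<open>1 \<le> \<theta>\<close>, the total \<open>e + e\<close> fits the same bound.\<close>
    have "dY (f x) y \<le> d (Inr (f x)) (Inl x) + d (Inl x) (Inr y)"
      using triangle[of "Inr (f x)" "Inl x" "Inr y"] f(1) x(1) y dY by (simp add: InlI InrI)
    also have "\<dots> < e + e"
      by (rule add_strict_mono[OF f(2)[OF x(1)] x(2)])
    also have "\<dots> \<le> e + \<theta> * e"
      using e assms(1) by simp
    finally show "\<exists>x\<in>X. dY (f x) y < (1 + \<theta>) * \<epsilon>"
      using x le by force
  qed
  then show ?thesis
    by blast
qed

section \<open>Passages and the glued metric\<close>

text \<open>Moving one summand across the inequality lets the infima be taken one at a time. It
  serves detours that leave and return by independently chosen arcs.\<close>

lemma cINF_add_greatest:
  fixes u :: "'a \<Rightarrow> real" and v :: "'b \<Rightarrow> real"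
  assumes "A \<noteq> {}" and "B \<noteq> {}" and "\<And>a b. \<lbrakk>a \<in> A; b \<in> B\<rbrakk> \<Longrightarrow> c \<le> u a + v b"
  shows "c \<le> (INF a\<in>A. u a) + (INF b\<in>B. v b)"
proof -
  have "c - u a \<le> (INF b\<in>B. v b)" if "a \<in> A" for a
    using assms that by (intro cINF_greatest) (auto simp: algebra_simps)
  then have "c - (INF b\<in>B. v b) \<le> (INF a\<in>A. u a)"
    using assms(1) by (intro cINF_greatest) (auto simp: algebra_simps)
  then show ?thesis
    by simp
qed

text \<open>The arc length is left out here and added in the glued distance, so estimates on
  passages do not depend on it.\<close>

definition passage :: "'a set \<Rightarrow> ('a \<Rightarrow> 'a \<Rightarrow> real) \<Rightarrow> ('b \<Rightarrow> 'b \<Rightarrow> real) \<Rightarrow> ('a \<Rightarrow> 'b) \<Rightarrow> 'a \<Rightarrow> 'b \<Rightarrow> real"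
  where "passage X dX dY f x y = (INF a\<in>X. dX x a + dY (f a) y)"

text \<open>Paths from \<open>Y\<close> to \<open>X\<close> are paths from \<open>X\<close> to \<open>Y\<close> for the reversed distances.\<close>

fun glued_dist ::
  "real \<Rightarrow> 'a set \<Rightarrow> ('a \<Rightarrow> 'a \<Rightarrow> real) \<Rightarrow> ('b \<Rightarrow> 'b \<Rightarrow> real) \<Rightarrow> ('a \<Rightarrow> 'b) \<Rightarrow> 'a + 'b \<Rightarrow> 'a + 'b \<Rightarrow> real"
  where
  "glued_dist c X dX dY f (Inl x) (Inl x') = dX x x'"
| "glued_dist c X dX dY f (Inr y) (Inr y') = dY y y'"
| "glued_dist c X dX dY f (Inl x) (Inr y) = passage X dX dY f x y + c"
| "glued_dist c X dX dY f (Inr y) (Inl x) = passage X (\<lambda>x a. dX a x) (\<lambda>b y. dY y b) f x y + c"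

text \<open>Nonnegativity bounds the lengths below, so the infimum is at most each of them. Being
  symmetric in the two arguments, the hypotheses hold equally for the reversed distances.\<close>

lemma passage_le:
  assumes "\<And>x x'. \<lbrakk>x \<in> X; x' \<in> X\<rbrakk> \<Longrightarrow> 0 \<le> dX x x'"
    and "\<And>y y'. \<lbrakk>y \<in> Y; y' \<in> Y\<rbrakk> \<Longrightarrow> 0 \<le> dY y y'"
    and "f \<in> X \<rightarrow> Y" and "x \<in> X" and "y \<in> Y" and "a \<in> X"
  shows "passage X dX dY f x y \<le> dX x a + dY (f a) y"
  unfolding passage_def
proof (rule cINF_lower[OF _ \<open>a \<in> X\<close>])
  have "0 \<le> dX x a + dY (f a) y" if "a \<in> X" for a
    using assms(1)[OF assms(4) that] assms(2)[OF funcset_mem[OF assms(3) that] assms(5)] by simp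
  then show "bdd_below ((\<lambda>a. dX x a + dY (f a) y) ` X)"
    by (rule bdd_belowI2)
qed

text \<open>The summand \<open>s\<close> is a leg outside the passage, so a triangle inequality can
  be checked arc by arc.\<close>

lemma passage_greatest:
  assumes "X \<noteq> {}" and "\<And>a. a \<in> X \<Longrightarrow> r \<le> dX x a + dY (f a) y + s"
  shows "r \<le> passage X dX dY f x y + s"
proof -
  have "r - s \<le> passage X dX dY f x y"
    unfolding passage_def using assms by (intro cINF_greatest) (auto simp: algebra_simps)
  then show ?thesis
    by simp
qed

text \<open>Every axiom is checked arc by arc and then passed to the infimum. The emptiness
  assumption makes these infima range over a nonempty set as soon as a point of \<open>Y\<close> is
  given.\<close>

lemma theta_metric_space_glued:
  assumes X: "theta_metric_space \<theta> X dX" and Y: "theta_metric_space \<theta> Y dY"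
    and "1 \<le> \<theta>" and "0 < \<epsilon>" and f: "f \<in> X \<rightarrow> Y" and "X = {} \<Longrightarrow> Y = {}"
    and distort: "\<And>x x'. \<lbrakk>x \<in> X; x' \<in> X\<rbrakk> \<Longrightarrow> \<bar>dY (f x) (f x') - dX x x'\<bar> \<le> \<epsilon>"
  shows "theta_metric_space \<theta> (X <+> Y) (glued_dist (\<epsilon> / 2) X dX dY f)"
proof -
  let ?dX = "\<lambda>x a. dX a x" and ?dY = "\<lambda>b y. dY y b"
  let ?P = "passage X dX dY f" and ?Q = "passage X ?dX ?dY f"
  let ?d = "glued_dist (\<epsilon> / 2) X dX dY f"
  note posX = theta_metric_nonneg[OF X] and posY = theta_metric_nonneg[OF Y]
  note triX = theta_metric_triangle[OF X] and triY = theta_metric_triangle[OF Y]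
  note revX = theta_metric_reverse[OF X] and revY = theta_metric_reverse[OF Y]
  have fY: "f a \<in> Y" if "a \<in> X" for a
    using f that by blast
  have ne: "X \<noteq> {}" if "y \<in> Y" for y
    using assms(6) that by blast
  have Ple: "?P x y \<le> dX x a + dY (f a) y" if "x \<in> X" "y \<in> Y" "a \<in> X" for x y a
    using that by (intro passage_le[of X dX Y dY] f posX posY)
  have Qle: "?Q x y \<le> dX a x + dY y (f a)" if "x \<in> X" "y \<in> Y" "a \<in> X" for x y a
    using that by (intro passage_le[of X ?dX Y ?dY, OF _ _ f] posX posY)
  have P0: "0 \<le> ?P x y" and Q0: "0 \<le> ?Q x y" if "x \<in> X" "y \<in> Y" for x y
    using passage_greatest[OF ne, of y 0 dX x dY f y 0] passage_greatest[OF ne, of y 0 ?dX x ?dY f y 0]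
      that posX posY fY by auto
  have PQ: "?P x y \<le> \<theta> * ?Q x y" and QP: "?Q x y \<le> \<theta> * ?P x y" if xy: "x \<in> X" "y \<in> Y" for x y
  proof -
    \<comment> \<open>Following the same arc backwards costs at most \<open>\<theta>\<close> times
      as much. Dividing by \<open>\<theta>\<close> isolates the passage on the right;
      \<open>+ 0\<close> is the empty extra leg.\<close>
    have "?P x y / \<theta> \<le> dX a x + dY y (f a) + 0" if "a \<in> X" for a
      using Ple[OF xy that] revX[OF xy(1) that] revY[OF fY[OF that] xy(2)] \<open>1 \<le> \<theta>\<close>
      by (simp add: divide_simps algebra_simps)
    from passage_greatest[OF ne[OF xy(2)], of _ ?dX x ?dY f y, OF this]
    show "?P x y \<le> \<theta> * ?Q x y"
      using \<open>1 \<le> \<theta>\<close> by (simp add: divide_simps algebra_simps)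
    have "?Q x y / \<theta> \<le> dX x a + dY (f a) y + 0" if "a \<in> X" for a
      using Qle[OF xy that] revX[OF that xy(1)] revY[OF xy(2) fY[OF that]] \<open>1 \<le> \<theta>\<close>
      by (simp add: divide_simps algebra_simps)
    from passage_greatest[OF ne[OF xy(2)], of _ dX x dY f y, OF this]
    show "?Q x y \<le> \<theta> * ?P x y"
      using \<open>1 \<le> \<theta>\<close> by (simp add: divide_simps algebra_simps)
  qed
  \<comment> \<open>The labels of the next six facts list the spaces containing the start, the
    middle and the end of a triangle inequality.\<close>
  have XXY: "?P x y \<le> ?P x' y + dX x x'" and YXX: "?Q x y \<le> ?Q x' y + dX x' x"
    if "x \<in> X" "x' \<in> X" "y \<in> Y" for x x' y
    using that ne[OF that(3)] Ple[OF that(1,3)] Qle[OF that(1,3)] triX[OF that(1,2)] triX[OF _ that(2,1)]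
    by (intro passage_greatest; force)+
  have XYY: "?P x y \<le> ?P x y' + dY y' y" and YYX: "?Q x y \<le> ?Q x y' + dY y y'"
    if "x \<in> X" "y \<in> Y" "y' \<in> Y" for x y y'
    using that ne[OF that(2)] Ple[OF that(1,2)] Qle[OF that(1,2)] triY[OF fY that(3,2)] triY[OF that(2,3) fY]
    by (intro passage_greatest; force)+
  have XYX: "dX x x' \<le> ?P x y + ?Q x' y + \<epsilon>" if "x \<in> X" "x' \<in> X" "y \<in> Y" for x x' y
  proof -
    \<comment> \<open>Join the arcs at \<open>a\<close> and \<open>b\<close> inside
      \<open>X\<close>: \<open>dX a b\<close> exceeds \<open>dY (f a) (f b)\<close> by at most
      \<open>\<epsilon>\<close>, and the latter is bounded by the way through
      \<open>y\<close>.\<close>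
    have "dX x x' - \<epsilon> \<le> (dX x a + dY (f a) y) + (dX b x' + dY y (f b))"
      if "a \<in> X" "b \<in> X" for a b
      using triX[of x a x'] triX[of a b x'] triY[of "f a" y "f b"] distort[of a b] fY that
        \<open>x \<in> X\<close> \<open>x' \<in> X\<close> \<open>y \<in> Y\<close> by force
    then have "dX x x' - \<epsilon> \<le> ?P x y + ?Q x' y"
      unfolding passage_def by (intro cINF_add_greatest ne[OF that(3)])
    then show ?thesis
      by simp
  qed
  have YXY: "dY y y' \<le> ?Q x y + ?P x y' + \<epsilon>" if "x \<in> X" "y \<in> Y" "y' \<in> Y" for x y y'
  proof -
    \<comment> \<open>Dually, the arcs are joined inside \<open>Y\<close>, where
      \<open>dY (f a) (f b)\<close> exceeds \<open>dX a b\<close> by at most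
      \<open>\<epsilon>\<close>.\<close>
    have "dY y y' - \<epsilon> \<le> (dX a x + dY y (f a)) + (dX x b + dY (f b) y')"
      if "a \<in> X" "b \<in> X" for a b
      using triX[of a x b] triY[of y "f a" y'] triY[of "f a" "f b" y'] distort[of a b] fY that
        \<open>x \<in> X\<close> \<open>y \<in> Y\<close> \<open>y' \<in> Y\<close> by force
    then have "dY y y' - \<epsilon> \<le> ?Q x y + ?P x y'"
      unfolding passage_def by (intro cINF_add_greatest ne[OF that(3)])
    then show ?thesis
      by simp
  qed
  \<comment> \<open>Points of different spaces are at distance at least
    \<open>\<epsilon> / 2\<close>, hence never 0; the arc length respects the reversal bound because
    \<open>1 \<le> \<theta>\<close>.\<close>
  have "0 \<le> ?d p q" "?d p q = 0 \<longleftrightarrow> p = q" "?d p q \<le> \<theta> * ?d q p"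
    if "p \<in> X <+> Y" "q \<in> X <+> Y" for p q
    using that \<open>1 \<le> \<theta>\<close> \<open>0 < \<epsilon>\<close> posX posY theta_metric_eq_0[OF X] theta_metric_eq_0[OF Y] revX revY
    by (auto simp: algebra_simps intro!: add_nonneg_nonneg add_mono PQ QP dest: P0 Q0)
  moreover have "?d p r \<le> ?d p q + ?d q r"
    if "p \<in> X <+> Y" "q \<in> X <+> Y" "r \<in> X <+> Y" for p q r
    using that triX triY XXY YXX XYY YYX XYX YXY by (auto simp: algebra_simps)
  ultimately show ?thesis
    unfolding theta_metric_space_def irreversible_metric_def by simp
qed

section \<open>From an approximate isometry to small distance\<close>

lemma theta_GH_le_of_eps_isometry:
  assumes "1 \<le> \<theta>" and "0 < \<epsilon>" and X: "theta_metric_space \<theta> X dX" and Y: "theta_metric_space \<theta> Y dY"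
    and iso: "eps_isometry \<epsilon> X dX Y dY f"
  shows "theta_GH_distance \<theta> X dX Y dY \<le> ereal (2 * \<epsilon>)"
proof -
  let ?d = "glued_dist (\<epsilon> / 2) X dX dY f" and ?Z = "X <+> Y"
  note f = eps_isometry_funcset[OF iso]
  \<comment> \<open>The slack \<open>\<epsilon> / 2\<close> is what remains of
    \<open>2 * \<epsilon>\<close> after \<open>\<epsilon>\<close> for almost-surjectivity and
    \<open>\<epsilon> / 2\<close> for the arc.\<close>
  have onto: "\<exists>x\<in>X. dY (f x) y < \<epsilon> + \<epsilon> / 2" if "y \<in> Y" for y
    using eps_isometry_almost_onto[OF iso Y _ _ that, of "\<epsilon> / 2"] assms(1,2) by simp
  have "theta_metric_space \<theta> ?Z ?d"
    using onto by (intro theta_metric_space_glued X Y assms f eps_isometry_distortion[OF iso]) auto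
  then have "theta_admissible \<theta> X dX Y dY ?d"
    by (simp add: theta_admissible_def)
  then have "theta_GH_distance \<theta> X dX Y dY \<le> hausdorff_distance ?Z ?d (Inl ` X) (Inr ` Y)"
    unfolding theta_GH_distance_def by (intro Inf_lower) blast
  also have "\<dots> \<le> ereal (2 * \<epsilon>)"
  proof -
    \<comment> \<open>The arc at \<open>x\<close> itself has both outer legs of length 0, so the
      distance is at most \<open>\<epsilon> / 2\<close>.\<close>
    have "?d (Inr (f x)) (Inl x) < 2 * \<epsilon>" if "x \<in> X" for x
      using passage_le[of X "\<lambda>x a. dX a x" Y "\<lambda>b y. dY y b" f x "f x" x] that f \<open>0 < \<epsilon>\<close>
        theta_metric_nonneg[OF X] theta_metric_nonneg[OF Y] theta_metric_eq_0[OF X that that]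
        theta_metric_eq_0[OF Y, of "f x" "f x"] by force
    \<comment> \<open>Take the arc from \<open>x\<close> to \<open>f x\<close> and continue to
      \<open>y\<close> inside \<open>Y\<close>.\<close>
    moreover have "?d (Inl x) (Inr y) < 2 * \<epsilon>"
      if "x \<in> X" "y \<in> Y" "dY (f x) y < \<epsilon> + \<epsilon> / 2" for x y
      using passage_le[of X dX Y dY f x y x] that f
        theta_metric_nonneg[OF X] theta_metric_nonneg[OF Y] theta_metric_eq_0[OF X that(1) that(1)]
      by force
    ultimately have "Inl ` X \<subseteq> enlargement ?Z ?d (Inr ` Y) (2 * \<epsilon>)"
      and "Inr ` Y \<subseteq> enlargement ?Z ?d (Inl ` X) (2 * \<epsilon>)"
      using f onto by (fastforce simp: mem_enlargement_iff simp del: glued_dist.simps)+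
    then show ?thesis
      unfolding hausdorff_distance_def using \<open>0 < \<epsilon>\<close> by (intro Inf_lower) force
  qed
  finally show ?thesis .
qed

theorem lemma3p15:
  fixes \<theta> \<epsilon> :: real
    and X :: "'a set" and dX :: "'a \<Rightarrow> 'a \<Rightarrow> real"
    and Y :: "'b set" and dY :: "'b \<Rightarrow> 'b \<Rightarrow> real"
  assumes "1 \<le> \<theta>" and "0 < \<epsilon>"
    and "compact_theta_metric_space \<theta> X dX"
    and "compact_theta_metric_space \<theta> Y dY"
  shows "(theta_GH_distance \<theta> X dX Y dY < ereal \<epsilon> \<longrightarrow>
            (\<exists>f. eps_isometry ((1 + \<theta>) * \<epsilon>) X dX Y dY f)) \<and>
         ((\<exists>f. eps_isometry \<epsilon> X dX Y dY f) \<longrightarrow>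
            theta_GH_distance \<theta> X dX Y dY \<le> ereal (2 * \<epsilon>))"
  using assms eps_isometry_of_theta_GH_less theta_GH_le_of_eps_isometry
  unfolding compact_theta_metric_space_def by blast

end
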